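(* Let $t\in\mathbb{R}\setminus\{0\}$. If $$\varDelta_t\overset{\mathrm{def}}{=}\frac{\partial^2}{\partial x_1^2}+\frac{\partial^2}{\partial x_2^2}-\frac{\mathrm{sgn}(t)\,\partial^2}{\partial x_3^2}-\frac{\mathrm{sgn}(t)\,\partial^2}{\partial x_4^2}\quad\text{on }\mathcal{F}_t,$$ then $$\varDelta_t=\nabla_t^{\dagger}\nabla_t .$$
   Context: For $t\in\mathbb{R}$, $\mathbb{H}_t$ (the $t$-scaled hypercomplexes) is the associative unital real algebra with $\mathbb{R}$-basis $\{1,i,j_t,k_t\}$ and multiplication determined by $i^2=-1$, $j_t^2=k_t^2=t$, $ij_t=k_t$, $j_tk_t=-ti$, $k_ti=j_t$, $j_ti=-k_t$, $ik_t=-j_t$, $k_tj_t=ti$. Its elements are written $w=x_1+x_2i+x_3j_t+x_4k_t$ with $x_1,x_2,x_3,x_4\in\mathbb{R}$. $\mathcal{T}_t$ is the topology on $\mathbb{H}_t$ induced by the semi-norm $\|w\|_t=\sqrt{|x_1^2+x_2^2-t(x_3^2+x_4^2)|}$. For a connected $U\in\mathcal{T}_t$, $\mathcal{F}_{t,U}$ is the set of functions $f:\mathbb{H}_t\to\mathbb{H}_t$ that are $\mathbb{R}$-differentiable on $U$ ($U$ being regarded as an open subset of $\mathbb{R}^4$), and $\mathcal{F}_t=\bigcup_{U}\mathcal{F}_{t,U}$. For $t\neq0$, $\mathrm{sgn}(t)=1$ if $t>0$ and $-1$ if $t<0$. The operators on $\mathcal{F}_{t,U}$ are $$\nabla_t=\frac{\partial}{\partial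 x_1}+i\frac{\partial}{\partial x_2}-j_t\frac{\mathrm{sgn}(t)\,\partial}{\sqrt{|t|}\,\partial x_3}-k_t\frac{\mathrm{sgn}(t)\,\partial}{\sqrt{|t|}\,\partial x_4},$$ $$\nabla_t^{\dagger}=\frac{\partial}{\partial x_1}-\frac{\partial}{\partial x_2}i+\frac{\mathrm{sgn}(t)\,\partial}{\sqrt{|t|}\,\partial x_3}j_t+\frac{\mathrm{sgn}(t)\,\partial}{\sqrt{|t|}\,\partial x_4}k_t,$$ where in $\nabla_t^{\dagger}\nabla_t$ the constant units multiply from the left.
   Formalization: The identity is stated for functions in F_t whose first partial derivatives are again R-differentiable on U (twice differentiable functions); for merely R-differentiable f second partials may not exist, or the mixed ones may differ and the identity fails. *)

theory Defs
  imports "HOL-Analysis.Analysis"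
begin

text \<open>
  The underlying real vector space of the scaled hypercomplexes is \<open>real ^ 4\<close> for every scale \<open>t\<close>:
  the vector \<open>w\<close> stands for \<open>w$1 + w$2 i + w$3 j\<^sub>t + w$4 k\<^sub>t\<close>, and only the multiplication,
  the semi-norm and the topology depend on \<open>t\<close>.
\<close>

type_synonym hypercomplex = "real ^ 4"

definition hc_one :: hypercomplex where "hc_one = axis 1 1"
definition hc_i :: hypercomplex where "hc_i = axis 2 1"
definition hc_j :: hypercomplex where "hc_j = axis 3 1"
definition hc_k :: hypercomplex where "hc_k = axis 4 1"

text \<open>The bilinear extension of the multiplication table; see \<open>hc_mult_table\<close> below.\<close>

definition hc_mult :: "real \<Rightarrow> hypercomplex \<Rightarrow> hypercomplex \<Rightarrow> hypercomplex" where
  "hc_mult t a b = vector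
    [a$1 * b$1 - a$2 * b$2 + t * (a$3 * b$3) + t * (a$4 * b$4),
     a$1 * b$2 + a$2 * b$1 - t * (a$3 * b$4) + t * (a$4 * b$3),
     a$1 * b$3 + a$3 * b$1 - a$2 * b$4 + a$4 * b$2,
     a$1 * b$4 + a$4 * b$1 + a$2 * b$3 - a$3 * b$2]"

lemma vector_4_nth:
  "(vector [x1, x2, x3, x4] :: ('a::zero) ^ 4) $ 1 = x1"
  "(vector [x1, x2, x3, x4] :: 'a ^ 4) $ 2 = x2"
  "(vector [x1, x2, x3, x4] :: 'a ^ 4) $ 3 = x3"
  "(vector [x1, x2, x3, x4] :: 'a ^ 4) $ 4 = x4"
  by (simp_all add: vector_def)

lemma hc_mult_nth:
  "hc_mult t a b $ 1 = a$1 * b$1 - a$2 * b$2 + t * (a$3 * b$3) + t * (a$4 * b$4)"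
  "hc_mult t a b $ 2 = a$1 * b$2 + a$2 * b$1 - t * (a$3 * b$4) + t * (a$4 * b$3)"
  "hc_mult t a b $ 3 = a$1 * b$3 + a$3 * b$1 - a$2 * b$4 + a$4 * b$2"
  "hc_mult t a b $ 4 = a$1 * b$4 + a$4 * b$1 + a$2 * b$3 - a$3 * b$2"
  unfolding hc_mult_def by (simp_all only: vector_4_nth)

lemma hc_mult_table:
  "hc_mult t hc_i hc_i = - hc_one"
  "hc_mult t hc_j hc_j = t *\<^sub>R hc_one"
  "hc_mult t hc_k hc_k = t *\<^sub>R hc_one"
  "hc_mult t hc_i hc_j = hc_k"
  "hc_mult t hc_j hc_k = - t *\<^sub>R hc_i"
  "hc_mult t hc_k hc_i = hc_j"
  "hc_mult t hc_j hc_i = - hc_k"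
  "hc_mult t hc_i hc_k = - hc_j"
  "hc_mult t hc_k hc_j = t *\<^sub>R hc_i"
  by (simp_all add: vec_eq_iff forall_4 hc_mult_nth hc_one_def hc_i_def hc_j_def hc_k_def axis_def)

lemma hc_mult_unit: "hc_mult t hc_one w = w" "hc_mult t w hc_one = w"
  by (simp_all add: vec_eq_iff forall_4 hc_mult_nth hc_one_def axis_def)

lemma hc_mult_assoc: "hc_mult t (hc_mult t a b) c = hc_mult t a (hc_mult t b c)"
  by (simp add: vec_eq_iff forall_4 hc_mult_nth algebra_simps)

lemma bilinear_hc_mult: "bilinear (hc_mult t)"
  unfolding bilinear_def
  by (auto intro!: linearI simp: vec_eq_iff forall_4 hc_mult_nth algebra_simps)

lemma hc_expand:
  "w = (w$1) *\<^sub>R hc_one + (w$2) *\<^sub>R hc_i + (w$3) *\<^sub>R hc_j + (w$4) *\<^sub>R hc_k"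
  by (simp add: vec_eq_iff forall_4 hc_one_def hc_i_def hc_j_def hc_k_def axis_def)

definition hc_seminorm :: "real \<Rightarrow> hypercomplex \<Rightarrow> real" where
  "hc_seminorm t w = sqrt \<bar>(w$1)\<^sup>2 + (w$2)\<^sup>2 - t * ((w$3)\<^sup>2 + (w$4)\<^sup>2)\<bar>"

definition hc_ball :: "real \<Rightarrow> hypercomplex \<Rightarrow> real \<Rightarrow> hypercomplex set" where
  "hc_ball t c r = {w. hc_seminorm t (w - c) < r}"

text \<open>
  For \<open>t > 0\<close> the triangle inequality fails for \<open>hc_seminorm t\<close> and the balls are not a base of a
  topology, so they are taken as a subbase.
\<close>

definition hc_topology :: "real \<Rightarrow> hypercomplex topology" where
  "hc_topology t = topology_generated_by {hc_ball t c r | c r. True}"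

lemma open_hc_ball: "open (hc_ball t c r)"
  unfolding hc_ball_def hc_seminorm_def by (intro open_Collect_less continuous_intros)

lemma openin_hc_topology_imp_open:
  assumes "openin (hc_topology t) U"
  shows "open U"
proof -
  have "generate_topology_on {hc_ball t c r | c r. True} U"
    using assms unfolding hc_topology_def openin_topology_generated_by_iff .
  then show ?thesis
    by induction (auto intro: open_hc_ball)
qed

definition hc_functions :: "real \<Rightarrow> hypercomplex set \<Rightarrow> (hypercomplex \<Rightarrow> hypercomplex) set" where
  "hc_functions t U =
    {f. openin (hc_topology t) U \<and> connectedin (hc_topology t) U \<and> f differentiable_on U}"

definition hc_partial ::
  "4 \<Rightarrow> (hypercomplex \<Rightarrow> hypercomplex) \<Rightarrow> hypercomplex \<Rightarrow> hypercomplex" where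
  "hc_partial m f w = vector_derivative (\<lambda>s. f (w + s *\<^sub>R axis m 1)) (at 0)"

text \<open>
  A function that is merely differentiable on \<open>U\<close> need not have second partial derivatives.
  The second-order operators act on those functions in \<open>hc_functions t U\<close> whose first partial
  derivatives are in \<open>hc_functions t U\<close> again, i.e. on the twice differentiable ones.
\<close>

definition hc_functions2 :: "real \<Rightarrow> hypercomplex set \<Rightarrow> (hypercomplex \<Rightarrow> hypercomplex) set" where
  "hc_functions2 t U =
    {f \<in> hc_functions t U. \<forall>m. hc_partial m f \<in> hc_functions t U}"

definition hc_nabla ::
  "real \<Rightarrow> (hypercomplex \<Rightarrow> hypercomplex) \<Rightarrow> hypercomplex \<Rightarrow> hypercomplex" where
  "hc_nabla t f w =
     hc_partial 1 f w
   + hc_mult t hc_i (hc_partial 2 f w)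
   - hc_mult t hc_j ((sgn t / sqrt \<bar>t\<bar>) *\<^sub>R hc_partial 3 f w)
   - hc_mult t hc_k ((sgn t / sqrt \<bar>t\<bar>) *\<^sub>R hc_partial 4 f w)"

text \<open>The units are written to the right of the derivatives in the symbol of this operator, but
  they act by left multiplication.\<close>

definition hc_nabla_dagger ::
  "real \<Rightarrow> (hypercomplex \<Rightarrow> hypercomplex) \<Rightarrow> hypercomplex \<Rightarrow> hypercomplex" where
  "hc_nabla_dagger t f w =
     hc_partial 1 f w
   - hc_mult t hc_i (hc_partial 2 f w)
   + hc_mult t hc_j ((sgn t / sqrt \<bar>t\<bar>) *\<^sub>R hc_partial 3 f w)
   + hc_mult t hc_k ((sgn t / sqrt \<bar>t\<bar>) *\<^sub>R hc_partial 4 f w)"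

definition hc_laplacian ::
  "real \<Rightarrow> (hypercomplex \<Rightarrow> hypercomplex) \<Rightarrow> hypercomplex \<Rightarrow> hypercomplex" where
  "hc_laplacian t f w =
     hc_partial 1 (hc_partial 1 f) w
   + hc_partial 2 (hc_partial 2 f) w
   - sgn t *\<^sub>R hc_partial 3 (hc_partial 3 f) w
   - sgn t *\<^sub>R hc_partial 4 (hc_partial 4 f) w"

end

theory Submission
  imports Defs
begin

text \<open>
  Expanding \<open>\<nabla>\<^sub>t\<^sup>\<dagger> \<nabla>\<^sub>t f\<close> with the multiplication table, the diagonal terms give the Laplacian, because
  \<open>(sgn t / sqrt \<bar>t\<bar>)\<^sup>2 t = sgn t\<close>, and the mixed terms cancel, because the units anticommute while the
  partial derivatives commute. No continuity of the second derivatives is assumed, so the latter is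
  Young's form of the symmetry theorem: if the first derivatives are Frechet differentiable at a
  point, both mixed derivatives there are the limit of the same symmetric second difference quotient.
\<close>

text \<open>The mean value inequality is applied along \<open>u\<close> to the first difference of
  \<open>f\<close> in the direction \<open>v\<close>. Its derivative is a difference of two values
  of \<open>fu\<close>, which the derivative of \<open>fu\<close> at \<open>w\<close> alone controls
  up to o(h).\<close>

lemma second_difference_bound:
  fixes f :: "'a::real_normed_vector \<Rightarrow> 'b::real_normed_vector"
  assumes f: "\<forall>\<^sub>F x in nhds w. ((\<lambda>s. f (x + s *\<^sub>R u)) has_vector_derivative fu x) (at 0)"
    and fu: "(fu has_derivative L) (at w)"
    and "e > 0"
  obtains d where "d > 0"
    and "\<And>h. \<lbrakk>0 < h; h < d\<rbrakk> \<Longrightarrow>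
      norm (f (w + h *\<^sub>R u + h *\<^sub>R v) - f (w + h *\<^sub>R u) - f (w + h *\<^sub>R v) + f w - h\<^sup>2 *\<^sub>R L v) \<le> e * h\<^sup>2"
proof -
  \<comment> \<open>Every corner and edge point of the parallelogram with sides
    \<open>h *\<^sub>R u\<close> and \<open>h *\<^sub>R v\<close> lies within \<open>h * K\<close>
    of \<open>w\<close>; the summand 1 keeps \<open>K\<close> positive when \<open>u\<close> and
    \<open>v\<close> vanish.\<close>
  define K where "K = norm u + norm v + 1"
  have K: "K > 0"
    unfolding K_def using norm_ge_zero[of u] norm_ge_zero[of v] by linarith
  have L: "bounded_linear L"
    using fu by (rule has_derivative_bounded_linear)
  obtain d1 where "d1 > 0"
    and d1: "\<And>x. norm (x - w) < d1 \<Longrightarrow> ((\<lambda>s. f (x + s *\<^sub>R u)) has_vector_derivative fu x) (at 0)"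
    using f by (auto simp: eventually_nhds_metric dist_norm)
  \<comment> \<open>At distance at most \<open>h * K\<close> this tolerance gives the error
    \<open>e / 2 * h\<close>, and two such errors will be added.\<close>
  have "e / (2 * K) > 0"
    using \<open>e > 0\<close> K by simp
  then obtain d2 where "d2 > 0"
    and d2: "\<And>x. norm (x - w) < d2 \<Longrightarrow>
      norm (fu x - fu w - L (x - w)) \<le> e / (2 * K) * norm (x - w)"
    using fu unfolding has_derivative_at_alt by blast
  define d where "d = min d1 d2 / K"
  have "d > 0"
    using \<open>d1 > 0\<close> \<open>d2 > 0\<close> K by (simp add: d_def)
  moreover have "norm (f (w + h *\<^sub>R u + h *\<^sub>R v) - f (w + h *\<^sub>R u) - f (w + h *\<^sub>R v) + f w - h\<^sup>2 *\<^sub>R L v)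
      \<le> e * h\<^sup>2" if h: "0 < h" "h < d" for h
  proof -
    have hK: "h * K < d1" "h * K < d2"
      using h K by (auto simp: d_def field_simps)
    have le: "norm (s *\<^sub>R u + r *\<^sub>R v) \<le> h * K" if "0 \<le> s" "s \<le> h" "0 \<le> r" "r \<le> h" for s r
    proof -
      have "norm (s *\<^sub>R u + r *\<^sub>R v) \<le> s * norm u + r * norm v"
        using that by (intro norm_triangle_le) simp
      also have "\<dots> \<le> h * norm u + h * norm v"
        using that by (intro add_mono mult_right_mono) auto
      also have "\<dots> \<le> h * K"
        using h by (simp add: K_def algebra_simps)
      finally show ?thesis .
    qed
    have der: "((\<lambda>s. f (w + s *\<^sub>R u + r *\<^sub>R v)) has_vector_derivative fu (w + s *\<^sub>R u + r *\<^sub>R v)) (at s)"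
      if "0 \<le> s" "s \<le> h" "0 \<le> r" "r \<le> h" for s r
    proof -
      \<comment> \<open>The hypothesis speaks of the parameter 0 only; moving the base point to the
        parameter \<open>s\<close> and composing with the shift by \<open>s\<close> transfers it.
        Writing 0 as \<open>s - s\<close> fits the chain rule.\<close>
      have "((\<lambda>q. f ((w + s *\<^sub>R u + r *\<^sub>R v) + q *\<^sub>R u)) has_vector_derivative fu (w + s *\<^sub>R u + r *\<^sub>R v)) (at (s - s))"
        using d1[of "w + s *\<^sub>R u + r *\<^sub>R v"] le[OF that] hK by (simp add: add.assoc)
      then have "((\<lambda>q. f ((w + s *\<^sub>R u + r *\<^sub>R v) + (q - s) *\<^sub>R u)) has_vector_derivative
          fu (w + s *\<^sub>R u + r *\<^sub>R v)) (at s)"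
        using vector_diff_chain_at[of "\<lambda>q. q - s" 1 s] has_vector_derivative_diff_const[of "\<lambda>q. q" s 1]
        by (simp add: o_def)
      then show ?thesis
        by (simp add: algebra_simps)
    qed
    have est: "norm (fu (w + s *\<^sub>R u + r *\<^sub>R v) - fu w - L (s *\<^sub>R u + r *\<^sub>R v)) \<le> e / 2 * h"
      if "0 \<le> s" "s \<le> h" "0 \<le> r" "r \<le> h" for s r
    proof -
      have "norm (fu (w + s *\<^sub>R u + r *\<^sub>R v) - fu w - L (s *\<^sub>R u + r *\<^sub>R v))
          \<le> e / (2 * K) * norm (s *\<^sub>R u + r *\<^sub>R v)"
        using d2[of "w + s *\<^sub>R u + r *\<^sub>R v"] le[OF that] hK by (simp add: add.assoc)
      also have "\<dots> \<le> e / (2 * K) * (h * K)"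
        using le[OF that] \<open>e > 0\<close> K by (intro mult_left_mono) auto
      finally show ?thesis
        using K by simp
    qed
    \<comment> \<open>The increment of \<open>g\<close> over \<open>{0..h}\<close> is exactly the
      quantity to be bounded. The summand \<open>0 *\<^sub>R v\<close> lets \<open>der\<close> and
      \<open>est\<close> apply with \<open>r = 0\<close>.\<close>
    define g where "g s = f (w + s *\<^sub>R u + h *\<^sub>R v) - f (w + s *\<^sub>R u + 0 *\<^sub>R v) - s *\<^sub>R L (h *\<^sub>R v)" for s
    define g' where "g' s = fu (w + s *\<^sub>R u + h *\<^sub>R v) - fu (w + s *\<^sub>R u + 0 *\<^sub>R v) - L (h *\<^sub>R v)" for s
    have g: "(g has_vector_derivative g' s) (at s)" if "0 \<le> s" "s \<le> h" for s
      unfolding g_def g'_def using that h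
      by (intro has_vector_derivative_diff der) (auto intro!: derivative_eq_intros)
    have "norm (g h - g 0) \<le> e * h * h - e * h * 0"
    proof (rule differentiable_bound_general[where f = g and \<phi> = "\<lambda>s. e * h * s" and f' = g'
          and \<phi>' = "\<lambda>_. e * h"])
      show "continuous_on {0..h} g"
        using g by (meson atLeastAtMost_iff continuous_at_imp_continuous_on
            has_vector_derivative_continuous)
      show "norm (g' s) \<le> e * h" if "0 < s" "s < h" for s
      proof -
        \<comment> \<open>The terms \<open>fu w\<close> and \<open>L (s *\<^sub>R u)\<close> cancel,
          so \<open>g' s\<close> is a difference of two first-order remainders of \<open>fu\<close>
          at \<open>w\<close>.\<close>
        have "g' s = (fu (w + s *\<^sub>R u + h *\<^sub>R v) - fu w - L (s *\<^sub>R u + h *\<^sub>R v))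
            - (fu (w + s *\<^sub>R u + 0 *\<^sub>R v) - fu w - L (s *\<^sub>R u + 0 *\<^sub>R v))"
          using L by (simp add: g'_def linear_simps)
        also have "norm \<dots> \<le> e / 2 * h + e / 2 * h"
          using that h by (intro norm_triangle_le_diff add_mono est) auto
        finally show ?thesis
          by simp
      qed
    qed (use h in \<open>auto intro!: g continuous_on_mult_left derivative_eq_intros
        simp flip: has_real_derivative_iff_has_vector_derivative\<close>)
    moreover have "g h - g 0 =
        f (w + h *\<^sub>R u + h *\<^sub>R v) - f (w + h *\<^sub>R u) - f (w + h *\<^sub>R v) + f w - h\<^sup>2 *\<^sub>R L v"
      using L by (simp add: g_def linear_simps power2_eq_square)
    ultimately show ?thesis
      by (simp add: power2_eq_square)
  qed
  ultimately show thesis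
    by (rule that)
qed

text \<open>The second difference is unchanged when \<open>u\<close> and \<open>v\<close> are
  swapped, so the preceding bound compares it with both \<open>h\<^sup>2 *\<^sub>R Lu v\<close> and
  \<open>h\<^sup>2 *\<^sub>R Lv u\<close>; one small \<open>h\<close> suffices for each
  \<open>e\<close>, since \<open>h\<^sup>2\<close> divides out.\<close>

lemma mixed_directional_derivatives_commute:
  fixes f :: "'a::real_normed_vector \<Rightarrow> 'b::real_normed_vector"
  assumes u: "\<forall>\<^sub>F x in nhds w. ((\<lambda>s. f (x + s *\<^sub>R u)) has_vector_derivative fu x) (at 0)"
    and v: "\<forall>\<^sub>F x in nhds w. ((\<lambda>s. f (x + s *\<^sub>R v)) has_vector_derivative fv x) (at 0)"
    and fu: "(fu has_derivative Lu) (at w)"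
    and fv: "(fv has_derivative Lv) (at w)"
  shows "Lu v = Lv u"
proof -
  have "norm (Lu v - Lv u) \<le> 0 + e" if "e > 0" for e
  proof -
    have "e / 2 > 0"
      using that by simp
    obtain d1 where "d1 > 0" and d1: "\<And>h. \<lbrakk>0 < h; h < d1\<rbrakk> \<Longrightarrow>
        norm (f (w + h *\<^sub>R u + h *\<^sub>R v) - f (w + h *\<^sub>R u) - f (w + h *\<^sub>R v) + f w - h\<^sup>2 *\<^sub>R Lu v) \<le> e / 2 * h\<^sup>2"
      using second_difference_bound[OF u fu \<open>e / 2 > 0\<close>] by blast
    obtain d2 where "d2 > 0" and d2: "\<And>h. \<lbrakk>0 < h; h < d2\<rbrakk> \<Longrightarrow>
        norm (f (w + h *\<^sub>R v + h *\<^sub>R u) - f (w + h *\<^sub>R v) - f (w + h *\<^sub>R u) + f w - h\<^sup>2 *\<^sub>R Lv u) \<le> e / 2 * h\<^sup>2"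
      using second_difference_bound[OF v fv \<open>e / 2 > 0\<close>] by blast
    define h where "h = min d1 d2 / 2"
    have h: "0 < h" "h < d1" "h < d2"
      using \<open>d1 > 0\<close> \<open>d2 > 0\<close> by (auto simp: h_def)
    have "h\<^sup>2 *\<^sub>R (Lu v - Lv u) =
        (f (w + h *\<^sub>R v + h *\<^sub>R u) - f (w + h *\<^sub>R v) - f (w + h *\<^sub>R u) + f w - h\<^sup>2 *\<^sub>R Lv u)
        - (f (w + h *\<^sub>R u + h *\<^sub>R v) - f (w + h *\<^sub>R u) - f (w + h *\<^sub>R v) + f w - h\<^sup>2 *\<^sub>R Lu v)"
      by (simp add: algebra_simps)
    also have "norm \<dots> \<le> e / 2 * h\<^sup>2 + e / 2 * h\<^sup>2"
      using h by (intro norm_triangle_le_diff add_mono d1 d2)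
    finally have "h\<^sup>2 * norm (Lu v - Lv u) \<le> h\<^sup>2 * e"
      by (simp add: mult.commute)
    then show ?thesis
      using h by simp
  qed
  then have "norm (Lu v - Lv u) \<le> 0"
    by (rule field_le_epsilon)
  then show ?thesis
    by simp
qed

lemma has_vector_derivative_along_line:
  assumes "(f has_derivative D) (at x)"
  shows "((\<lambda>s. f (x + s *\<^sub>R u)) has_vector_derivative D u) (at 0)"
proof -
  have "((\<lambda>s::real. x + s *\<^sub>R u) has_derivative (\<lambda>s. s *\<^sub>R u)) (at 0)"
    by (auto intro!: derivative_eq_intros)
  then have "((\<lambda>s. f (x + s *\<^sub>R u)) has_derivative (\<lambda>s. D (s *\<^sub>R u))) (at 0)"
    using assms by (auto dest!: has_derivative_compose[where g = f and g' = D])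
  moreover have "linear D"
    using assms by (rule has_derivative_linear)
  ultimately show ?thesis
    by (simp add: has_vector_derivative_def linear_scale)
qed

text \<open>\<open>vector_derivative\<close> is a choice operator, meaningful only where a
  derivative exists; Frechet differentiability supplies one and fixes the value.\<close>

lemma hc_partial_eq:
  assumes "(f has_derivative D) (at w)"
  shows "hc_partial m f w = D (axis m 1)"
  unfolding hc_partial_def
  using has_vector_derivative_along_line[OF assms] by (rule vector_derivative_at)

text \<open>A set open for the semi-norm topology is Euclidean open, so differentiability within
  \<open>U\<close> is differentiability at its points.\<close>

lemma hc_functions_differentiable:
  assumes "f \<in> hc_functions t U" "w \<in> U"
  shows "f differentiable (at w)"
proof -
  have "open U"
    using assms(1) openin_hc_topology_imp_open by (auto simp: hc_functions_def)
  then show ?thesis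
    using assms by (simp add: hc_functions_def differentiable_on_eq_differentiable_at)
qed

lemma hc_partial_commute:
  assumes f: "f \<in> hc_functions2 t U" and w: "w \<in> U"
  shows "hc_partial m (hc_partial n f) w = hc_partial n (hc_partial m f) w"
proof -
  have "open U"
    using f openin_hc_topology_imp_open by (auto simp: hc_functions2_def hc_functions_def)
  have line: "\<forall>\<^sub>F x in nhds w.
      ((\<lambda>s. f (x + s *\<^sub>R axis k 1)) has_vector_derivative hc_partial k f x) (at 0)" for k
  proof (rule eventually_nhds_in_open[OF \<open>open U\<close> w, THEN eventually_mono])
    fix x assume "x \<in> U"
    then obtain D where D: "(f has_derivative D) (at x)"
      using f hc_functions_differentiable[of f t U x]
      by (auto simp: hc_functions2_def differentiable_def)
    then show "((\<lambda>s. f (x + s *\<^sub>R axis k 1)) has_vector_derivative hc_partial k f x) (at 0)"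
      using has_vector_derivative_along_line[OF D] by (simp add: hc_partial_eq)
  qed
  have "hc_partial k f differentiable (at w)" for k
    using f w by (intro hc_functions_differentiable[of _ t U]) (auto simp: hc_functions2_def)
  then obtain D where D: "\<And>k. (hc_partial k f has_derivative D k) (at w)"
    unfolding differentiable_def by metis
  show ?thesis
    \<comment> \<open>\<open>D n\<close> evaluated at \<open>axis m 1\<close> is the partial
      derivative in direction \<open>m\<close> of \<open>hc_partial n f\<close>.\<close>
    using mixed_directional_derivatives_commute[OF line line D D, of n m]
    by (simp add: hc_partial_eq[OF D])
qed

lemma bounded_linear_hc_mult_right: "bounded_linear (hc_mult t a)"
  using bilinear_hc_mult[of t] by (simp add: bilinear_def flip: linear_conv_bounded_linear)

text \<open>Left multiplication by a constant unit is bounded linear, hence commutes with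
  differentiation.\<close>

lemma hc_partial_nabla:
  assumes "\<And>k. hc_partial k f differentiable (at w)"
  shows "hc_partial m (hc_nabla t f) w =
     hc_partial m (hc_partial 1 f) w
   + hc_mult t hc_i (hc_partial m (hc_partial 2 f) w)
   - hc_mult t hc_j ((sgn t / sqrt \<bar>t\<bar>) *\<^sub>R hc_partial m (hc_partial 3 f) w)
   - hc_mult t hc_k ((sgn t / sqrt \<bar>t\<bar>) *\<^sub>R hc_partial m (hc_partial 4 f) w)"
proof -
  obtain D where D: "\<And>k. (hc_partial k f has_derivative D k) (at w)"
    using assms unfolding differentiable_def by metis
  note mult = bounded_linear.has_derivative[OF bounded_linear_hc_mult_right]
  have "(hc_nabla t f has_derivative (\<lambda>x. D 1 x + hc_mult t hc_i (D 2 x)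
      - hc_mult t hc_j ((sgn t / sqrt \<bar>t\<bar>) *\<^sub>R D 3 x)
      - hc_mult t hc_k ((sgn t / sqrt \<bar>t\<bar>) *\<^sub>R D 4 x))) (at w)"
    unfolding hc_nabla_def [abs_def]
    by (intro has_derivative_add has_derivative_diff mult has_derivative_scaleR_right D)
  then show ?thesis
    by (simp add: hc_partial_eq[OF D] hc_partial_eq)
qed

theorem theorem33:
  fixes t :: real
    and U :: "hypercomplex set"
    and f :: "hypercomplex \<Rightarrow> hypercomplex"
    and w :: hypercomplex
  assumes "t \<noteq> 0"
    and "f \<in> hc_functions2 t U"
    and "w \<in> U"
  shows "hc_laplacian t f w = hc_nabla_dagger t (hc_nabla t f) w"
proof -
  define c where "c = sgn t / sqrt \<bar>t\<bar>"
  have c: "sgn t = t * (c * c)"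
  proof -
    have "c * c = 1 / \<bar>t\<bar>"
      using \<open>t \<noteq> 0\<close> by (simp add: c_def sgn_if flip: real_sqrt_mult)
    then show ?thesis
      using \<open>t \<noteq> 0\<close> by (simp add: sgn_if)
  qed
  have diff: "hc_partial k f differentiable (at w)" for k
    using assms by (intro hc_functions_differentiable[of _ t U]) (auto simp: hc_functions2_def)
  define P where "P m n = hc_partial m (hc_partial n f) w" for m n
  \<comment> \<open>Oriented towards increasing indices, these equations serve as terminating
    rewrite rules.\<close>
  have sym: "P 2 1 = P 1 2" "P 3 1 = P 1 3" "P 4 1 = P 1 4" "P 3 2 = P 2 3" "P 4 2 = P 2 4" "P 4 3 = P 3 4"
    unfolding P_def by (rule hc_partial_commute[OF assms(2,3)])+
  show ?thesis
    \<comment> \<open>Once the coefficients are folded into \<open>c\<close>, \<open>sgn t\<close>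
      remains only in the Laplacian. Replacing it by \<open>t * (c * c)\<close> leaves in each
      coordinate a polynomial identity in \<open>t\<close>, \<open>c\<close> and the coordinates of
      the \<open>P m n\<close>.\<close>
    unfolding hc_laplacian_def hc_nabla_dagger_def hc_partial_nabla[OF diff]
      c_def [symmetric] P_def [symmetric] sym vec_eq_iff forall_4
    by (simp add: hc_mult_nth hc_i_def hc_j_def hc_k_def axis_def, simp only: c, intro conjI; algebra)
qed

end
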